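(* Let $(X,d,\ll,\leq,\tau)$ be a locally causally closed and sufficiently causally connected Lorentzian pre-length space. Let $T: X \to \mathbb{R}$ be a time function and suppose that $X$ is equipped with the null distance $d_T$ with respect to $T$ (i.e. the metric $d$ of $X$ is $d_T$). Assume that $(X,d_T)$ is complete and that $X$ has approximate $\tau$-midpoints. Assume further that there exist $c \in (0,\frac{1}{2}]$ and $\hat{\varepsilon}>0$ such that for any $p, q \in X$ with $p \ll q$ there is a $\tau(p,q)\hat{\varepsilon}$-$\tau$-midpoint $m$ of $p$ and $q$ such that $$(1-c)\, T(p) + c\, T(q) \leq T(m) \leq c\, T(p) + (1-c)\, T(q).$$ Then $X$ is intrinsic.
   Context: A Lorentzian pre-length space is a tuple $(X,d,\ll,\leq,\tau)$ where $(X,d)$ is a metric space, $\leq$ is a reflexive and transitive relation on $X$, $\ll$ is a transitive relation contained in $\leq$, and $\tau: X\times X\to[0,\infty]$ is lower semicontinuous (with respect to $d$) such that $\tau(x,z)\geq\tau(x,y)+\tau(y,z)$ whenever $x\leq y\leq z$, $\tau(x,y)=0$ if $x\not\leq y$, and $\tau(x,y)>0$ if and only if $x\ll y$. Write $x<y$ if $x\leq y$ and $x\neq y$. All topological notions refer to the metric of $X$. A future-directed causal (resp. timelike) curve is a non-constant locally Lipschitz curve $\gamma:I\to X$, $I$ an interval, with $\gamma(s)\leq\gamma(t)$ (resp. $\gamma(s)\ll\gamma(t)$) for all $s<t$ in $I$; past-directed curves are defined with the relations reversed. Causal and timelike curves are future-directed unless stated otherwise. The $\tau$-length of a causal curve $\gamma:[a,b]\to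 X$ is $L_\tau(\gamma)=\inf\{\sum_{i=0}^{n-1}\tau(\gamma(t_i),\gamma(t_{i+1})) : a=t_0<t_1<\dots<t_n=b,\ n\in\mathbb{N}\}$. $X$ is intrinsic if $\tau$ is given by the supremum of lengths of causal curves, i.e. $\tau(x,y)=\sup\{L_\tau(\gamma) : \gamma \text{ future-directed causal curve from } x \text{ to } y\}$ for all $x,y\in X$, where the supremum is set to $0$ if there is no such curve. $X$ is locally causally closed if every point has a neighbourhood $U$ such that $\leq|_{\bar U\times\bar U}$ is closed, i.e. if $p_n\to p$, $q_n\to q$, $p_n,q_n\in U$, $p,q\in\bar U$, $p_n\leq q_n$ for all $n$, then $p\leq q$. $X$ is causally path-connected if for all $x<y$ there is a causal curve from $x$ to $y$ and for all $x\ll y$ there is a timelike curve from $x$ to $y$. $X$ is sufficiently causally connected if it is path-connected, causally path-connected and every point lies on a timelike curve. For $x\ll z$ and $\varepsilon>0$, a point $y\in X$ is an $\varepsilon$-$\tau$-midpoint of $x$ and $z$ if $|\tau(x,y)-\frac12\tau(x,z)|<\varepsilon$ and $|\tau(y,z)-\frac12\tau(x,z)|<\varepsilon$. $X$ has approximate $\tau$-midpoints if any pair of points $x\ll z$ has an $\varepsilon$-$\tau$-midpoint for all $\varepsilon>0$. A generalized time function is a function $T:X\to\mathbb{R}$ with $x<y\Rightarrow T(x)<T(y)$; a time function is a continuous generalized time function. A curve $\gamma:[a,b]\to X$ is piecewise causal if there is a partition $a=t_0<t_1<\dots<t_n=b$ such that each $\gamma|_{[t_i,t_{i+1}]}$ is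 a future-directed or past-directed causal curve. Its null length is $L_T(\gamma)=\sum_{i=0}^{n-1}|T(\gamma(t_{i+1}))-T(\gamma(t_i))|$. The null distance is $d_T(p,q)=\inf\{L_T(\gamma) : \gamma \text{ is piecewise causal from } p \text{ to } q\}$. *)

theory Defs
  imports "HOL-Analysis.Analysis"
begin

text \<open>
  The metric space \<open>(X, d)\<close> is a type of class \<open>metric_space\<close> with \<open>d = dist\<close>; the relations
  \<open>\<lless>\<close> and \<open>\<le>\<close> on \<open>X\<close> are written \<open>chron\<close> and \<open>causal\<close>.
\<close>

locale lorentzian_pre_length_space =
  fixes chron causal :: "'a::metric_space \<Rightarrow> 'a \<Rightarrow> bool"
    and \<tau> :: "'a \<Rightarrow> 'a \<Rightarrow> ennreal"
  assumes causal_refl: "reflp causal"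
    and causal_trans: "transp causal"
    and chron_trans: "transp chron"
    and chron_imp_causal: "\<And>x y. chron x y \<Longrightarrow> causal x y"
    and tau_lower_semicontinuous:
      "\<And>x y. \<tau> x y \<le> Liminf (nhds (x, y)) (\<lambda>(u, v). \<tau> u v)"
    and tau_reverse_triangle:
      "\<And>x y z. causal x y \<Longrightarrow> causal y z \<Longrightarrow> \<tau> x y + \<tau> y z \<le> \<tau> x z"
    and tau_eq_0: "\<And>x y. \<not> causal x y \<Longrightarrow> \<tau> x y = 0"
    and tau_pos_iff: "\<And>x y. \<tau> x y > 0 \<longleftrightarrow> chron x y"

definition locally_lipschitz_on :: "real set \<Rightarrow> (real \<Rightarrow> 'a::metric_space) \<Rightarrow> bool" where
  "locally_lipschitz_on I \<gamma> \<longleftrightarrow>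
     (\<forall>t\<in>I. \<exists>u>0. \<exists>L. L-lipschitz_on (cball t u \<inter> I) \<gamma>)"

text \<open>
  With \<open>R = causal\<close> (\<open>R = chron\<close>) these are the future-directed causal (timelike) curves on the
  interval \<open>I\<close>; the past-directed ones are obtained with the converse relation.
\<close>

definition directed_curve ::
    "('a::metric_space \<Rightarrow> 'a \<Rightarrow> bool) \<Rightarrow> real set \<Rightarrow> (real \<Rightarrow> 'a) \<Rightarrow> bool" where
  "directed_curve R I \<gamma> \<longleftrightarrow>
     is_interval I \<and> \<not> \<gamma> constant_on I \<and> locally_lipschitz_on I \<gamma> \<and>
     (\<forall>s\<in>I. \<forall>t\<in>I. s < t \<longrightarrow> R (\<gamma> s) (\<gamma> t))"

definition directed_curve_from_to ::
    "('a::metric_space \<Rightarrow> 'a \<Rightarrow> bool) \<Rightarrow> 'a \<Rightarrow> 'a \<Rightarrow> real \<Rightarrow> real \<Rightarrow> (real \<Rightarrow> 'a) \<Rightarrow> bool" where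
  "directed_curve_from_to R x y a b \<gamma> \<longleftrightarrow>
     a \<le> b \<and> directed_curve R {a..b} \<gamma> \<and> \<gamma> a = x \<and> \<gamma> b = y"

definition is_partition :: "real \<Rightarrow> real \<Rightarrow> nat \<Rightarrow> (nat \<Rightarrow> real) \<Rightarrow> bool" where
  "is_partition a b n t \<longleftrightarrow> t 0 = a \<and> t n = b \<and> (\<forall>i<n. t i < t (Suc i))"

definition tau_length ::
    "('a \<Rightarrow> 'a \<Rightarrow> ennreal) \<Rightarrow> real \<Rightarrow> real \<Rightarrow> (real \<Rightarrow> 'a) \<Rightarrow> ennreal" where
  "tau_length \<tau> a b \<gamma> =
     Inf {(\<Sum>i<n. \<tau> (\<gamma> (t i)) (\<gamma> (t (Suc i)))) | n t. is_partition a b n t}"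

text \<open>The supremum of the empty set in \<open>ennreal\<close> is \<open>0\<close>.\<close>

definition intrinsic ::
    "('a::metric_space \<Rightarrow> 'a \<Rightarrow> bool) \<Rightarrow> ('a \<Rightarrow> 'a \<Rightarrow> ennreal) \<Rightarrow> bool" where
  "intrinsic causal \<tau> \<longleftrightarrow>
     (\<forall>x y. \<tau> x y = Sup {tau_length \<tau> a b \<gamma> | a b \<gamma>. directed_curve_from_to causal x y a b \<gamma>})"

definition locally_causally_closed :: "('a::metric_space \<Rightarrow> 'a \<Rightarrow> bool) \<Rightarrow> bool" where
  "locally_causally_closed causal \<longleftrightarrow>
     (\<forall>x. \<exists>U. x \<in> interior U \<and>
        (\<forall>P Q p q. P \<longlonglongrightarrow> p \<longrightarrow> Q \<longlonglongrightarrow> q \<longrightarrow> (\<forall>n::nat. P n \<in> U \<and> Q n \<in> U) \<longrightarrow>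
           p \<in> closure U \<longrightarrow> q \<in> closure U \<longrightarrow> (\<forall>n. causal (P n) (Q n)) \<longrightarrow> causal p q))"

definition causally_path_connected ::
    "('a::metric_space \<Rightarrow> 'a \<Rightarrow> bool) \<Rightarrow> ('a \<Rightarrow> 'a \<Rightarrow> bool) \<Rightarrow> bool" where
  "causally_path_connected chron causal \<longleftrightarrow>
     (\<forall>x y. causal x y \<and> x \<noteq> y \<longrightarrow> (\<exists>a b \<gamma>. directed_curve_from_to causal x y a b \<gamma>)) \<and>
     (\<forall>x y. chron x y \<longrightarrow> (\<exists>a b \<gamma>. directed_curve_from_to chron x y a b \<gamma>))"

definition sufficiently_causally_connected ::
    "('a::metric_space \<Rightarrow> 'a \<Rightarrow> bool) \<Rightarrow> ('a \<Rightarrow> 'a \<Rightarrow> bool) \<Rightarrow> bool" where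
  "sufficiently_causally_connected chron causal \<longleftrightarrow>
     path_connected (UNIV :: 'a set) \<and> causally_path_connected chron causal \<and>
     (\<forall>x. \<exists>I \<gamma>. directed_curve chron I \<gamma> \<and> x \<in> \<gamma> ` I)"

text \<open>
  The absolute difference on \<open>[0, \<infinity>]\<close>. Subtraction on \<open>ennreal\<close> is truncated, and
  \<open>\<infinity> - \<infinity> = \<infinity>\<close> there; the case distinction fixes the convention \<open>\<bar>\<infinity> - \<infinity>\<bar> = 0\<close>, so that
  having approximate midpoints does not exclude the value \<open>\<infinity>\<close> of \<open>\<tau>\<close>.
\<close>

definition ennreal_abs_diff :: "ennreal \<Rightarrow> ennreal \<Rightarrow> ennreal" where
  "ennreal_abs_diff a b = (if a = b then 0 else max (a - b) (b - a))"

definition tau_midpoint ::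
    "('a \<Rightarrow> 'a \<Rightarrow> ennreal) \<Rightarrow> ennreal \<Rightarrow> 'a \<Rightarrow> 'a \<Rightarrow> 'a \<Rightarrow> bool" where
  "tau_midpoint \<tau> \<epsilon> x z y \<longleftrightarrow>
     ennreal_abs_diff (\<tau> x y) (\<tau> x z / 2) < \<epsilon> \<and>
     ennreal_abs_diff (\<tau> y z) (\<tau> x z / 2) < \<epsilon>"

definition approximate_tau_midpoints ::
    "('a \<Rightarrow> 'a \<Rightarrow> bool) \<Rightarrow> ('a \<Rightarrow> 'a \<Rightarrow> ennreal) \<Rightarrow> bool" where
  "approximate_tau_midpoints chron \<tau> \<longleftrightarrow>
     (\<forall>x z. chron x z \<longrightarrow> (\<forall>\<epsilon>::real. \<epsilon> > 0 \<longrightarrow> (\<exists>y. tau_midpoint \<tau> (ennreal \<epsilon>) x z y)))"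

definition generalized_time_function :: "('a \<Rightarrow> 'a \<Rightarrow> bool) \<Rightarrow> ('a \<Rightarrow> real) \<Rightarrow> bool" where
  "generalized_time_function causal T \<longleftrightarrow> (\<forall>x y. causal x y \<and> x \<noteq> y \<longrightarrow> T x < T y)"

definition is_time_function :: "('a::metric_space \<Rightarrow> 'a \<Rightarrow> bool) \<Rightarrow> ('a \<Rightarrow> real) \<Rightarrow> bool" where
  "is_time_function causal T \<longleftrightarrow> generalized_time_function causal T \<and> continuous_on UNIV T"

definition piecewise_causal ::
    "('a::metric_space \<Rightarrow> 'a \<Rightarrow> bool) \<Rightarrow> real \<Rightarrow> real \<Rightarrow> nat \<Rightarrow> (nat \<Rightarrow> real) \<Rightarrow> (real \<Rightarrow> 'a) \<Rightarrow> bool" where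
  "piecewise_causal causal a b n t \<gamma> \<longleftrightarrow>
     is_partition a b n t \<and> a < b \<and>
     (\<forall>i<n. directed_curve causal {t i..t (Suc i)} \<gamma> \<or>
            directed_curve (conversep causal) {t i..t (Suc i)} \<gamma>)"

definition null_length :: "('a \<Rightarrow> real) \<Rightarrow> nat \<Rightarrow> (nat \<Rightarrow> real) \<Rightarrow> (real \<Rightarrow> 'a) \<Rightarrow> real" where
  "null_length T n t \<gamma> = (\<Sum>i<n. \<bar>T (\<gamma> (t (Suc i))) - T (\<gamma> (t i))\<bar>)"

text \<open>
  The null length of a curve does not depend on the witnessing partition when \<open>T\<close> is a
  generalized time function, so the infimum may range over curves together with a partition.
  Taken in \<open>ennreal\<close>, it is \<open>\<infinity>\<close> if no piecewise causal curve exists.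
\<close>

definition null_distance ::
    "('a::metric_space \<Rightarrow> 'a \<Rightarrow> bool) \<Rightarrow> ('a \<Rightarrow> real) \<Rightarrow> 'a \<Rightarrow> 'a \<Rightarrow> ennreal" where
  "null_distance causal T p q =
     Inf {ennreal (null_length T n t \<gamma>) | a b n t \<gamma>.
            piecewise_causal causal a b n t \<gamma> \<and> \<gamma> a = p \<and> \<gamma> b = q}"

end

theory Submission imports Defs begin

text \<open>
  Causal curves from \<open>x\<close> to \<open>y\<close> are never longer than \<open>\<tau> x y\<close>, by the trivial partition. For
  the converse, let \<open>r < \<tau> x y\<close>; a causal curve of \<open>\<tau>\<close>-length at least \<open>r\<close> is constructed as the
  closure of a countable causal chain on which the values of \<open>T\<close> are dense in \<open>[T x, T y]\<close>.

  The chain is a limit of finite chains. Each link \<open>(a, b)\<close> of such a finite chain carries a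
  weight \<open>w \<ge> 0\<close> with \<open>w < \<tau> a b\<close>, and refinements never lower the total weight, which starts
  as \<open>r\<close>. Two demands compete. Small weights come from approximate midpoints: because
  \<open>r < \<tau> p q\<close> is strict, some \<open>m\<close> satisfies \<open>r / 2 < \<tau> p m\<close> and \<open>r / 2 < \<tau> m q\<close>, so iteration
  splits \<open>r\<close> into \<open>2 ^ n\<close> equal parts without loss. The times of these midpoints
  are arbitrary: some links may keep a large time gap forever. Small time gaps come from points on timelike curves, but those
  points may destroy the weight. The two are reconciled by counting: at most
  \<open>(T q - T p) / \<eta>\<close> links have a time gap \<open>\<ge> \<eta>\<close>, so once all weights equal a tiny \<open>w\<close>, sacrificing
  the weight of exactly these links and filling them by timelike curves costs at most
  \<open>w / \<eta> * (T q - T p)\<close>. Starting from a slightly larger \<open>r' < \<tau> p q\<close> pays for this. Hence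
  every weighted link can be subdivided into links whose weights and time gaps are all below any
  given \<open>\<eta> > 0\<close>, with no loss of weight (\<open>admissible_refinement\<close>).

  Iterating with \<open>\<eta> = 1 / n\<close> gives the dense chain. The null distance of causally related points
  is the difference of their times, so \<open>T\<close> is an isometry on the chain and, by completeness, maps
  its closure onto \<open>[T x, T y]\<close>; the inverse is a curve. Local causal closedness makes it causal:
  it relates a limit point to nearby chain points, which exist by density of the times, and
  transitivity does the rest (\<open>curve_through_dense_chain\<close>).

  For the length, compare a partition of the curve into \<open>N\<close> pieces with the \<open>n\<close>-th finite chain. By
  the reverse triangle inequality, the links that lie within one piece contribute at most the
  \<open>\<tau>\<close> of that piece; at most \<open>N\<close> links straddle a partition point, and together they weigh at
  most \<open>N / n\<close> (\<open>chain_weight_le_partition_sum\<close>). As \<open>n\<close> grows, the partition sum is seen to be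
  at least \<open>r\<close>. Only lower bounds on \<open>\<tau>\<close> enter, so the case \<open>\<tau> x y = \<infinity>\<close> is covered as well.
\<close>

section \<open>Weighted chains\<close>

text \<open>
  The weight of a link is a guaranteed real amount below \<open>\<tau>\<close> rather than \<open>\<tau>\<close> itself: it can be
  distributed among subdivisions, it is finite, and it can be made small although \<open>\<tau>\<close> of the link
  admits no useful upper bound.
\<close>

datatype 'a link = Link (src: 'a) (tgt: 'a) (wt: real)

fun chain :: "'a \<Rightarrow> 'a link list \<Rightarrow> 'a \<Rightarrow> bool" where
  "chain p [] q \<longleftrightarrow> p = q"
| "chain p (l # ls) q \<longleftrightarrow> src l = p \<and> chain (tgt l) ls q"

definition points :: "'a link list \<Rightarrow> 'a set" where
  "points ls = src ` set ls \<union> tgt ` set ls"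

abbreviation weight :: "'a link list \<Rightarrow> real" where
  "weight ls \<equiv> (\<Sum>l\<leftarrow>ls. wt l)"

definition subdivides :: "'a link list \<Rightarrow> 'a link \<Rightarrow> bool" where
  "subdivides ls l \<longleftrightarrow> ls \<noteq> [] \<and> chain (src l) ls (tgt l) \<and> wt l \<le> weight ls"

lemma chain_append: "chain p (ks @ ls) q \<longleftrightarrow> (\<exists>m. chain p ks m \<and> chain m ls q)"
  by (induction ks arbitrary: p) auto

lemma chain_endpoints:
  assumes "chain p ls q" "ls \<noteq> []"
  shows "p \<in> points ls" "q \<in> points ls"
proof -
  show "p \<in> points ls"
    using assms by (cases ls) (auto simp: points_def)
  show "q \<in> points ls"
    using assms
  proof (induction ls arbitrary: p)
    case (Cons l ls)
    then show ?case by (cases ls) (auto simp: points_def)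
  qed simp
qed

lemma chain_concat:
  assumes "chain p ls q" and "\<And>l. l \<in> set ls \<Longrightarrow> chain (src l) (f l) (tgt l)"
  shows "chain p (concat (map f ls)) q"
  using assms by (induction ls arbitrary: p) (auto simp: chain_append)

lemma points_concat:
  assumes "\<And>l. l \<in> set ls \<Longrightarrow> subdivides (f l) l"
  shows "points ls \<subseteq> points (concat (map f ls))"
proof -
  have "src l \<in> points (f l) \<and> tgt l \<in> points (f l)" if "l \<in> set ls" for l
    using assms[OF that] chain_endpoints by (force simp: subdivides_def)
  then show ?thesis
    by (fastforce simp: points_def)
qed

lemma subdivides_concat:
  assumes "subdivides ls l" and sub: "\<And>k. k \<in> set ls \<Longrightarrow> subdivides (f k) k"
  shows "subdivides (concat (map f ls)) l"
proof -
  have "weight ls \<le> (\<Sum>k\<leftarrow>ls. weight (f k))"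
    using sub by (intro sum_list_mono) (auto simp: subdivides_def)
  also have "\<dots> = weight (concat (map f ls))"
    by (induction ls) auto
  finally have "weight ls \<le> weight (concat (map f ls))" .
  then show ?thesis
    using assms chain_concat[of "src l" ls "tgt l" f]
    by (cases ls) (auto simp: subdivides_def)
qed

text \<open>
  Dependent choice for subdivisions. It is applied to the halving of weights, to the halving of
  time gaps and to the simultaneous refinement of both.
\<close>

lemma iterated_subdivision:
  fixes P :: "nat \<Rightarrow> 'a link \<Rightarrow> bool"
  assumes "P 0 l"
    and step: "\<And>n k. P n k \<Longrightarrow> \<exists>ls. subdivides ls k \<and> (\<forall>k'\<in>set ls. P (Suc n) k')"
  obtains G where "G 0 = [l]" and "\<And>n. subdivides (G n) l"
    and "\<And>n k. k \<in> set (G n) \<Longrightarrow> P n k"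
    and "\<And>n. points (G n) \<subseteq> points (G (Suc n))"
proof -
  obtain f where f: "\<And>n k. P n k \<Longrightarrow> subdivides (f n k) k \<and> (\<forall>k'\<in>set (f n k). P (Suc n) k')"
    using step by metis
  define G where "G = rec_nat [l] (\<lambda>n ls. concat (map (f n) ls))"
  have G0: "G 0 = [l]" and GS: "G (Suc n) = concat (map (f n) (G n))" for n
    by (simp_all add: G_def)
  have P: "\<forall>k\<in>set (G n). P n k" for n
    by (induction n) (use assms(1) f in \<open>auto simp: G0 GS\<close>)
  have "subdivides (G n) l" for n
  proof (induction n)
    case 0
    show ?case by (simp add: G0 subdivides_def)
  next
    case (Suc n)
    then show ?case
      unfolding GS using P f by (intro subdivides_concat) auto
  qed
  moreover have "points (G n) \<subseteq> points (G (Suc n))" for n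
    unfolding GS using P f by (intro points_concat) auto
  ultimately show ?thesis
    using that[of G] G0 P by blast
qed

text \<open>A discrete intermediate value theorem: some link leaves \<open>A\<close>.\<close>

lemma chain_crossing:
  assumes "chain p ls q" "A p" "\<not> A q"
  obtains ls1 l ls2 where "ls = ls1 @ l # ls2" "chain p ls1 (src l)" "chain (tgt l) ls2 q"
    "A (src l)" "\<not> A (tgt l)"
proof -
  have "\<exists>ls1 l ls2. ls = ls1 @ l # ls2 \<and> chain p ls1 (src l) \<and> chain (tgt l) ls2 q \<and>
      A (src l) \<and> \<not> A (tgt l)"
    using assms
  proof (induction ls arbitrary: p)
    case (Cons k ls)
    show ?case
    proof (cases "A (tgt k)")
      case True
      with Cons have "\<exists>ls1 l ls2. ls = ls1 @ l # ls2 \<and> chain (tgt k) ls1 (src l) \<and>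
          chain (tgt l) ls2 q \<and> A (src l) \<and> \<not> A (tgt l)"
        by simp
      then obtain ls1 l ls2 where "ls = ls1 @ l # ls2" "chain (tgt k) ls1 (src l)"
        "chain (tgt l) ls2 q" "A (src l)" "\<not> A (tgt l)"
        by blast
      with Cons.prems show ?thesis
        by (intro exI[of _ "k # ls1"] exI[of _ l] exI[of _ ls2]) auto
    next
      case False
      with Cons.prems show ?thesis
        by (intro exI[of _ "[]"] exI[of _ k] exI[of _ ls]) auto
    qed
  qed auto
  with that show ?thesis by blast
qed

lemma chain_telescope:
  fixes T :: "'a \<Rightarrow> real"
  assumes "chain p ls q"
  shows "(\<Sum>l\<leftarrow>ls. T (tgt l) - T (src l)) = T q - T p"
  using assms by (induction ls arbitrary: p) auto

section \<open>Causal relation and time separation\<close>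

context lorentzian_pre_length_space
begin

lemma causal_reflD: "causal x x"
  using causal_refl by (simp add: reflpD)

lemma causal_transD: "causal x y \<Longrightarrow> causal y z \<Longrightarrow> causal x z"
  using causal_trans by (meson transpD)

lemma tau_mono:
  assumes "causal u x" "causal x y" "causal y v"
  shows "\<tau> x y \<le> \<tau> u v"
proof -
  have "\<tau> x y \<le> \<tau> u x + \<tau> x y" by simp
  also have "\<dots> \<le> \<tau> u y" using assms by (intro tau_reverse_triangle)
  also have "\<dots> \<le> \<tau> u y + \<tau> y v" by simp
  also have "\<dots> \<le> \<tau> u v" using assms causal_transD by (intro tau_reverse_triangle) blast+
  finally show ?thesis .
qed

definition admissible :: "'a link \<Rightarrow> bool" where
  "admissible l \<longleftrightarrow> 0 \<le> wt l \<and> ennreal (wt l) < \<tau> (src l) (tgt l)"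

lemma admissible_chron: "admissible l \<Longrightarrow> chron (src l) (tgt l)"
  unfolding admissible_def using tau_pos_iff by (metis le_less_trans zero_le)

lemma admissible_causal: "admissible l \<Longrightarrow> causal (src l) (tgt l)"
  by (simp add: admissible_chron chron_imp_causal)

lemma chain_weight_le_tau:
  assumes "chain p ls q" "\<forall>l\<in>set ls. admissible l"
  shows "causal p q" "ennreal (weight ls) \<le> \<tau> p q"
proof -
  have "causal p q \<and> ennreal (weight ls) \<le> \<tau> p q \<and> 0 \<le> weight ls"
    using assms
  proof (induction ls arbitrary: p)
    case Nil
    then show ?case by (auto simp: causal_reflD)
  next
    case (Cons l ls)
    then have IH: "causal (tgt l) q" "ennreal (weight ls) \<le> \<tau> (tgt l) q" "0 \<le> weight ls"
      and l: "admissible l" "src l = p"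
      by auto
    have w: "0 \<le> wt l" "ennreal (wt l) \<le> \<tau> p (tgt l)" "causal p (tgt l)"
      using l admissible_causal[of l] by (auto simp: admissible_def)
    have "ennreal (weight (l # ls)) = ennreal (wt l) + ennreal (weight ls)"
      using w IH by (simp add: ennreal_plus)
    also have "\<dots> \<le> \<tau> p (tgt l) + \<tau> (tgt l) q"
      using w IH by (intro add_mono)
    also have "\<dots> \<le> \<tau> p q"
      using w IH by (intro tau_reverse_triangle)
    finally show ?case
      using w IH causal_transD by auto
  qed
  then show "causal p q" "ennreal (weight ls) \<le> \<tau> p q" by auto
qed

lemma chain_points_between:
  assumes "chain p ls q" "\<forall>l\<in>set ls. admissible l" "u \<in> points ls"
  shows "causal p u" "causal u q"
proof -
  have "causal p u \<and> causal u q"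
    using assms
  proof (induction ls arbitrary: p)
    case (Cons l ls)
    then have l: "src l = p" "causal p (tgt l)" "causal (tgt l) q"
      using admissible_causal chain_weight_le_tau(1)[of "tgt l" ls q] by auto
    from Cons.prems consider "u = p" | "u = tgt l" | "u \<in> points ls"
      by (auto simp: points_def)
    then show ?case
      using l Cons causal_transD[of p] causal_reflD by cases (auto intro: causal_transD)
  qed (auto simp: points_def)
  then show "causal p u" "causal u q" by auto
qed

lemma chain_points_total:
  assumes "chain p ls q" "\<forall>l\<in>set ls. admissible l" "u \<in> points ls" "v \<in> points ls"
  shows "causal u v \<or> causal v u"
  using assms
proof (induction ls arbitrary: p)
  case (Cons l ls)
  then have tl: "chain (tgt l) ls q" "\<forall>k\<in>set ls. admissible k" by auto
  have first: "causal p w" if "w \<in> points (l # ls)" for w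
    using chain_points_between(1)[OF Cons.prems(1,2) that] .
  have second: "causal (tgt l) w" if "w = tgt l \<or> w \<in> points ls" for w
    using that chain_points_between(1)[OF tl] causal_reflD by auto
  have cases: "w = p \<or> w = tgt l \<or> w \<in> points ls" if "w \<in> points (l # ls)" for w
    using that Cons.prems(1) by (auto simp: points_def)
  show ?case
    using cases[OF Cons.prems(3)] cases[OF Cons.prems(4)] first second Cons.prems(3,4)
      Cons.IH[OF tl]
    by blast
qed (auto simp: points_def)

text \<open>
  Induction on the number of cells, peeling off the first one. The link that crosses the point
  \<open>z (Suc 0)\<close> separates the chain: what precedes it lies in the first cell and is bounded by the
  \<open>\<tau>\<close> of that cell, the crossing link itself costs \<open>\<eta>\<close>, and the induction hypothesis applies to
  what follows. That rest may begin later than \<open>z (Suc 0)\<close>, so the statement only asks for the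
  first cell to begin no later than the chain.
\<close>

lemma chain_weight_le_partition_sum:
  fixes \<eta> :: real
  assumes irrefl: "\<And>u. \<tau> u u = 0" and "0 \<le> \<eta>"
    and "chain p ls q" "\<forall>l\<in>set ls. admissible l \<and> wt l \<le> \<eta>"
    and "causal (z 0) p" "causal q (z N)"
    and "\<And>i. i < N \<Longrightarrow> causal (z i) (z (Suc i))"
    and "\<And>i u. i \<le> N \<Longrightarrow> u \<in> insert q (points ls) \<Longrightarrow> causal u (z i) \<or> causal (z i) u"
  shows "ennreal (weight ls) \<le> (\<Sum>i<N. \<tau> (z i) (z (Suc i))) + of_nat N * ennreal \<eta>"
  using assms(3-)
proof (induction N arbitrary: z p ls)
  case 0
  note pq = chain_weight_le_tau[OF "0.prems"(1)]
  have "ennreal (weight ls) \<le> \<tau> p q" using 0 pq by auto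
  also have "\<tau> p q \<le> \<tau> (z 0) (z 0)" using 0 pq by (intro tau_mono) auto
  finally show ?case by (simp add: irrefl)
next
  case (Suc N)
  let ?S = "\<Sum>i<N. \<tau> (z (Suc i)) (z (Suc (Suc i)))"
  have adm: "\<forall>l\<in>set ls. admissible l" using Suc.prems by auto
  have IH: "ennreal (weight ks) \<le> ?S + of_nat N * ennreal \<eta>"
    if "chain m ks q" "set ks \<subseteq> set ls" "causal (z (Suc 0)) m" for m ks
  proof (rule Suc.IH[of m ks "\<lambda>i. z (Suc i)"])
    show "causal u (z (Suc i)) \<or> causal (z (Suc i)) u" if "i \<le> N" "u \<in> insert q (points ks)"
      for i u
      using Suc.prems(6)[of "Suc i" u] that \<open>set ks \<subseteq> set ls\<close> by (auto simp: points_def)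
  qed (use that Suc.prems in auto)
  have split: "(\<Sum>i<Suc N. \<tau> (z i) (z (Suc i))) = \<tau> (z 0) (z (Suc 0)) + ?S"
    by (rule sum.lessThan_Suc_shift)
  have eta: "of_nat (Suc N) * ennreal \<eta> = ennreal \<eta> + of_nat N * ennreal \<eta>"
    by (simp add: distrib_right)
  have le: "causal p q" "ennreal (weight ls) \<le> \<tau> p q"
    using chain_weight_le_tau[OF Suc.prems(1) adm] by auto
  show ?case
  proof (cases "causal p (z (Suc 0))")
    case False
    \<comment> \<open>The chain begins beyond the first cell, which can be dropped.\<close>
    have "p \<in> insert q (points ls)"
      using Suc.prems(1) chain_endpoints(1)[of p ls q] by (cases ls) auto
    then have "causal (z (Suc 0)) p"
      using False Suc.prems(6)[of "Suc 0" p] by auto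
    from IH[OF Suc.prems(1) _ this] have "ennreal (weight ls) \<le> ?S + of_nat N * ennreal \<eta>" 
      by simp
    also have "\<dots> \<le> (\<tau> (z 0) (z (Suc 0)) + ?S) + of_nat (Suc N) * ennreal \<eta>"
      unfolding eta by (intro add_mono) auto
    finally show ?thesis unfolding split .
  next
    case p: True
    show ?thesis
    proof (cases "causal q (z (Suc 0))")
      case True
      \<comment> \<open>The whole chain lies in the first cell.\<close>
      note le(2)
      also have "\<tau> p q \<le> \<tau> (z 0) (z (Suc 0))"
        using True le Suc.prems by (intro tau_mono) auto
      also have "\<dots> \<le> (\<tau> (z 0) (z (Suc 0)) + ?S) + of_nat (Suc N) * ennreal \<eta>"
        by (simp add: add.assoc)
      finally show ?thesis unfolding split .
    next
      case False
      obtain ls1 l ls2 where ls: "ls = ls1 @ l # ls2" "chain p ls1 (src l)"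
        "chain (tgt l) ls2 q" "causal (src l) (z (Suc 0))" "\<not> causal (tgt l) (z (Suc 0))"
        using chain_crossing[OF Suc.prems(1), of "\<lambda>u. causal u (z (Suc 0))"] p False by metis
      have "causal (z (Suc 0)) (tgt l)"
        using Suc.prems(6)[of "Suc 0" "tgt l"] ls by (auto simp: points_def)
      then have 2: "ennreal (weight ls2) \<le> ?S + of_nat N * ennreal \<eta>"
        using ls by (intro IH) auto
      have "causal p (src l)" "ennreal (weight ls1) \<le> \<tau> p (src l)"
        using chain_weight_le_tau[OF ls(2)] adm ls by auto
      moreover from this have "\<tau> p (src l) \<le> \<tau> (z 0) (z (Suc 0))"
        using ls Suc.prems by (intro tau_mono) auto
      ultimately have 1: "ennreal (weight ls1) \<le> \<tau> (z 0) (z (Suc 0))" by auto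
      have nn: "\<forall>k\<in>set ls. 0 \<le> wt k" using adm by (auto simp: admissible_def)
      have "0 \<le> weight ls1" "0 \<le> wt l" "0 \<le> weight ls2"
        using nn ls(1) by (auto intro!: sum_list_nonneg)
      then have "ennreal (weight ls) =
          ennreal (weight ls1) + (ennreal (wt l) + ennreal (weight ls2))"
        using ls(1) by (simp add: ennreal_plus)
      also have "\<dots> \<le> \<tau> (z 0) (z (Suc 0)) + (ennreal \<eta> + (?S + of_nat N * ennreal \<eta>))"
        using 1 2 Suc.prems(2) ls by (intro add_mono ennreal_leI) auto
      also have "\<dots> = (\<tau> (z 0) (z (Suc 0)) + ?S) + of_nat (Suc N) * ennreal \<eta>"
        unfolding eta by (simp add: algebra_simps)
      finally show ?thesis unfolding split .
    qed
  qed
qed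

text \<open>
  The strict inequality leaves room for the error of the midpoint, so that halving is exact and
  can be iterated without bookkeeping. If \<open>\<tau> p q = \<infinity>\<close>, an approximate midpoint has infinite
  \<open>\<tau>\<close> on both sides, since every finite value has infinite distance from \<open>\<infinity> / 2 = \<infinity>\<close>.
\<close>

lemma approximate_midpoint:
  assumes "approximate_tau_midpoints chron \<tau>" "0 \<le> r" "ennreal r < \<tau> p q"
  obtains m where "ennreal (r / 2) < \<tau> p m" "ennreal (r / 2) < \<tau> m q"
proof -
  have chron: "chron p q"
    using assms(3) tau_pos_iff by (metis le_less_trans zero_le)
  have key: "ennreal (r / 2) < t"
    if "ennreal_abs_diff t (\<tau> p q / 2) < ennreal \<epsilon>" "0 < \<epsilon>"
      "\<tau> p q = top \<or> ennreal (r + 2 * \<epsilon>) \<le> \<tau> p q" for t \<epsilon>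
  proof (cases "\<tau> p q = top")
    case True
    then show ?thesis
      using that by (cases "t = top")
        (auto simp: ennreal_abs_diff_def ennreal_divide_eq_top_iff ennreal_top_divide
          ennreal_top_minus split: if_splits)
  next
    case False
    then obtain s where s: "\<tau> p q = ennreal s" "0 \<le> s"
      by (cases "\<tau> p q") auto
    have s2: "\<tau> p q / 2 = ennreal (s / 2)"
      using s by (simp add: divide_ennreal[symmetric] flip: ennreal_numeral)
    have "ennreal (r + 2 * \<epsilon>) \<le> ennreal s"
      using that False s by auto
    then have rs: "r + 2 * \<epsilon> \<le> s"
      using s ennreal_le_iff by blast
    show ?thesis
    proof (cases t)
      case (real u)
      have "ennreal (s / 2) - ennreal u < ennreal \<epsilon>"
        using that(1) unfolding s2 real
        by (cases "u = s / 2") (use that(2) in \<open>auto simp: ennreal_abs_diff_def split: if_splits\<close>)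
      then have "s / 2 - u < \<epsilon>"
        using real s that(2) by (auto simp: ennreal_minus ennreal_less_iff)
          (metis ennreal_less_iff ennreal_minus le_cases diff_ge_0_iff_ge diff_le_0_iff_le le_less_trans)
      then show ?thesis
        using rs real assms(2) by (auto simp: ennreal_less_iff)
    qed auto
  qed
  obtain \<epsilon> where \<epsilon>: "0 < \<epsilon>" "\<tau> p q = top \<or> ennreal (r + 2 * \<epsilon>) \<le> \<tau> p q"
  proof (cases "\<tau> p q")
    case (real s)
    then have "r < s" using assms by (auto simp: ennreal_less_iff)
    then show ?thesis using real that[of "(s - r) / 2"] by (auto simp: field_simps)
  next
    case top
    then show ?thesis using that[of 1] by auto
  qed
  then obtain m where "tau_midpoint \<tau> (ennreal \<epsilon>) p q m"
    using assms(1) chron unfolding approximate_tau_midpoints_def by blast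
  then have "ennreal (r / 2) < \<tau> p m" "ennreal (r / 2) < \<tau> m q"
    using key[OF _ \<epsilon>] unfolding tau_midpoint_def by blast+
  then show ?thesis by (rule that)
qed

end

section \<open>Null distance and time functions\<close>

lemma locally_lipschitz_imp_continuous:
  assumes "locally_lipschitz_on I \<gamma>"
  shows "continuous_on I \<gamma>"
  unfolding continuous_on_eq_continuous_within
proof
  fix t assume t: "t \<in> I"
  then obtain u L where uL: "0 < u" "L-lipschitz_on (cball t u \<inter> I) \<gamma>"
    using assms by (auto simp: locally_lipschitz_on_def)
  then have "continuous (at t within cball t u \<inter> I) \<gamma>"
    using t lipschitz_on_continuous_on[OF uL(2)] by (simp add: continuous_on_eq_continuous_within)
  moreover have "at t within cball t u \<inter> I = at t within I"
    using uL by (intro at_within_nhd[of t "ball t u"]) auto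
  ultimately show "continuous (at t within I) \<gamma>" by simp
qed

locale null_distance_space = lorentzian_pre_length_space chron causal \<tau>
  for chron causal :: "'a::metric_space \<Rightarrow> 'a \<Rightarrow> bool" and \<tau> +
  fixes T :: "'a \<Rightarrow> real"
  assumes connected: "causally_path_connected chron causal"
    and strict_time: "is_time_function causal T"
    and null_dist: "null_distance causal T p q = ennreal (dist p q)"
begin

lemma time_less: "causal x y \<Longrightarrow> x \<noteq> y \<Longrightarrow> T x < T y"
  using strict_time by (auto simp: is_time_function_def generalized_time_function_def)

lemma continuous_time: "continuous_on UNIV T"
  using strict_time by (auto simp: is_time_function_def)

lemma directed_curve_less:
  assumes "directed_curve_from_to R x y a b \<gamma>"
  shows "a < b"
proof (rule ccontr)
  assume "\<not> a < b"
  then have "\<gamma> t = \<gamma> a" if "t \<in> {a..b}" for t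
    using that by (cases "t = a") auto
  then have "\<gamma> constant_on {a..b}" unfolding constant_on_def by blast
  then show False
    using assms by (simp add: directed_curve_from_to_def directed_curve_def)
qed

text \<open>
  Any causal curve from \<open>p\<close> to \<open>q\<close> has null length \<open>T q - T p\<close>; no piecewise causal curve is
  shorter, by telescoping.
\<close>

lemma dist_causal:
  assumes "causal p q"
  shows "dist p q = T q - T p"
proof (cases "p = q")
  case False
  then have less: "T p < T q" using assms time_less by blast
  obtain a b \<gamma> where \<gamma>: "directed_curve_from_to causal p q a b \<gamma>"
    using connected assms False unfolding causally_path_connected_def by blast
  have "a < b" using directed_curve_less[OF \<gamma>] .
  then have pc: "piecewise_causal causal a b 1 (\<lambda>i. if i = 0 then a else b) \<gamma>"
    using \<gamma> by (simp add: piecewise_causal_def is_partition_def directed_curve_from_to_def)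
  have "null_length T 1 (\<lambda>i. if i = 0 then a else b) \<gamma> = T q - T p"
    using \<gamma> less by (simp add: null_length_def directed_curve_from_to_def)
  then have "null_distance causal T p q \<le> ennreal (T q - T p)"
    unfolding null_distance_def using pc \<gamma>
    by (intro Inf_lower) (force simp: directed_curve_from_to_def)
  moreover have "ennreal (T q - T p) \<le> null_distance causal T p q"
    unfolding null_distance_def
  proof (rule Inf_greatest, safe, rule ennreal_leI)
    fix a b n t \<gamma>
    assume "piecewise_causal causal a b n t \<gamma>" "p = \<gamma> a" "q = \<gamma> b"
    then have "T q - T p = T (\<gamma> (t n)) - T (\<gamma> (t 0))"
      by (simp add: piecewise_causal_def is_partition_def)
    also have "\<dots> = (\<Sum>i<n. T (\<gamma> (t (Suc i))) - T (\<gamma> (t i)))"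
      by (rule sum_lessThan_telescope[symmetric])
    also have "\<dots> \<le> null_length T n t \<gamma>"
      unfolding null_length_def by (intro sum_mono) simp
    finally show "T (\<gamma> b) - T (\<gamma> a) \<le> null_length T n t \<gamma>"
      using \<open>p = \<gamma> a\<close> \<open>q = \<gamma> b\<close> by simp
  qed
  ultimately show ?thesis
    using null_dist[of p q] less by simp
qed simp

text \<open>A timelike curve from \<open>x\<close> to \<open>x\<close> would be a non-constant loop along which \<open>T\<close> increases.\<close>

lemma chron_irrefl: "\<not> chron x x"
proof
  assume "chron x x"
  then obtain a b \<gamma> where \<gamma>: "directed_curve_from_to chron x x a b \<gamma>"
    using connected \<open>chron x x\<close> unfolding causally_path_connected_def by blast
  then obtain s where s: "s \<in> {a..b}" "\<gamma> s \<noteq> x"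
    unfolding directed_curve_from_to_def directed_curve_def constant_on_def by metis
  with \<gamma> have "a < s" "s < b"
    by (auto simp: directed_curve_from_to_def order_less_le)
  have "chron (\<gamma> a) (\<gamma> s)" "chron (\<gamma> s) (\<gamma> b)"
    using \<gamma> s(1) \<open>a < s\<close> \<open>s < b\<close> unfolding directed_curve_from_to_def directed_curve_def
    by (meson atLeastAtMost_iff less_imp_le order_refl)+
  then have "chron x (\<gamma> s)" "chron (\<gamma> s) x"
    using \<gamma> by (simp_all add: directed_curve_from_to_def)
  then have "T x < T (\<gamma> s)" "T (\<gamma> s) < T x"
    using s time_less chron_imp_causal by metis+
  then show False by simp
qed

lemma chron_time_less: "chron x y \<Longrightarrow> T x < T y"
  using time_less chron_imp_causal chron_irrefl by metis

lemma tau_refl: "\<tau> x x = 0"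
  using tau_pos_iff[of x x] chron_irrefl by (simp add: zero_less_iff_neq_zero)

lemma timelike_time_bisection:
  assumes "chron p q"
  obtains m where "chron p m" "chron m q" "T m = (T p + T q) / 2"
proof -
  obtain a b \<gamma> where \<gamma>: "directed_curve_from_to chron p q a b \<gamma>"
    using connected assms unfolding causally_path_connected_def by blast
  then have ab: "a \<le> b" "\<gamma> a = p" "\<gamma> b = q"
    by (auto simp: directed_curve_from_to_def)
  have "continuous_on {a..b} \<gamma>"
    using \<gamma> locally_lipschitz_imp_continuous
    by (auto simp: directed_curve_from_to_def directed_curve_def)
  then have "continuous_on {a..b} (\<lambda>t. T (\<gamma> t))"
    using continuous_on_compose2[OF continuous_time] by blast
  then obtain s where s: "a \<le> s" "s \<le> b" "T (\<gamma> s) = (T p + T q) / 2"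
    using IVT'[of "\<lambda>t. T (\<gamma> t)" a "(T p + T q) / 2" b] ab chron_time_less[OF assms] by auto
  then have "a < s" "s < b"
    using ab chron_time_less[OF assms] by (auto simp: order_less_le)
  then show ?thesis
    using that[of "\<gamma> s"] s ab \<gamma> by (auto simp: directed_curve_from_to_def directed_curve_def)
qed

section \<open>Refining a chain\<close>

abbreviation gap :: "'a link \<Rightarrow> real" where
  "gap l \<equiv> T (tgt l) - T (src l)"

text \<open>
  Weight \<open>0\<close> is admissible on every timelike link, so bisecting the time is all that is needed when
  the weight is given up.
\<close>

lemma fine_chain_from_bisection:
  assumes "chron p q" "0 < \<eta>"
  obtains ls where "ls \<noteq> []" "chain p ls q"
    "\<And>l. l \<in> set ls \<Longrightarrow> admissible l \<and> wt l = 0 \<and> gap l < \<eta>"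
proof -
  define P where "P = (\<lambda>n l. chron (src l) (tgt l) \<and> wt l = 0 \<and> gap l = (T q - T p) / 2 ^ n)"
  have step: "\<exists>ls. subdivides ls k \<and> (\<forall>k'\<in>set ls. P (Suc n) k')" if "P n k" for n k
  proof -
    have k: "chron (src k) (tgt k)" "wt k = 0" "gap k / 2 = (T q - T p) / 2 ^ Suc n"
      using that by (auto simp: P_def)
    obtain m where m: "chron (src k) m" "chron m (tgt k)" "T m = (T (src k) + T (tgt k)) / 2"
      using timelike_time_bisection[OF k(1)] by blast
    have "T m - T (src k) = gap k / 2" "T (tgt k) - T m = gap k / 2"
      unfolding m(3) by (simp_all add: field_simps)
    then have "P (Suc n) (Link (src k) m 0)" "P (Suc n) (Link m (tgt k) 0)"
      unfolding P_def using m(1,2) k(3) by (simp_all only: link.sel)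
    then show ?thesis
      using k(2) by (intro exI[of _ "[Link (src k) m 0, Link m (tgt k) 0]"])
        (simp add: subdivides_def)
  qed
  have base: "P 0 (Link p q 0)" using assms by (simp add: P_def)
  obtain G where "G 0 = [Link p q 0]"
    and G: "\<And>n. subdivides (G n) (Link p q 0)" "\<And>n k. k \<in> set (G n) \<Longrightarrow> P n k"
    and "\<And>n. points (G n) \<subseteq> points (G (Suc n))"
    by (rule iterated_subdivision[of P, OF base step], assumption) (rule that)
  have "(\<lambda>n. (T q - T p) / 2 ^ n) \<longlonglongrightarrow> 0"
    using LIMSEQ_divide_realpow_zero[of 2 "T q - T p"] by simp
  then have "\<forall>\<^sub>F n in sequentially. (T q - T p) / 2 ^ n < \<eta>"
    using assms(2) by (rule order_tendstoD)
  then obtain n where "(T q - T p) / 2 ^ n < \<eta>"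
    by (auto simp: eventually_sequentially)
  then show ?thesis
    using that[of "G n"] G(1)[of n] G(2)[of _ n] tau_pos_iff
    by (auto simp: P_def subdivides_def admissible_def)
qed

lemma even_chain_from_midpoints:
  assumes "approximate_tau_midpoints chron \<tau>" "0 \<le> r" "ennreal r < \<tau> p q"
  obtains ls where "ls \<noteq> []" "chain p ls q" "r \<le> weight ls"
    "\<And>l. l \<in> set ls \<Longrightarrow> admissible l \<and> wt l = r / 2 ^ n"
proof -
  define P where "P = (\<lambda>n l. admissible l \<and> wt l = r / 2 ^ n)"
  have step: "\<exists>ls. subdivides ls k \<and> (\<forall>k'\<in>set ls. P (Suc n) k')" if "P n k" for n k
  proof -
    have "0 \<le> wt k" "ennreal (wt k) < \<tau> (src k) (tgt k)"
      using that by (auto simp: P_def admissible_def)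
    then obtain m where "ennreal (wt k / 2) < \<tau> (src k) m" "ennreal (wt k / 2) < \<tau> m (tgt k)"
      using approximate_midpoint[OF assms(1)] by metis
    with that assms(2) show ?thesis
      by (intro exI[of _ "[Link (src k) m (wt k / 2), Link m (tgt k) (wt k / 2)]"])
        (auto simp: P_def subdivides_def admissible_def)
  qed
  have base: "P 0 (Link p q r)" using assms by (simp add: P_def admissible_def)
  obtain G where "G 0 = [Link p q r]"
    and "\<And>n. subdivides (G n) (Link p q r)" "\<And>n k. k \<in> set (G n) \<Longrightarrow> P n k"
    and "\<And>n. points (G n) \<subseteq> points (G (Suc n))"
    by (rule iterated_subdivision[of P, OF base step], assumption) (rule that)
  then show ?thesis
    using that[of "G n"] by (auto simp: P_def subdivides_def)
qed

text \<open>
  The heart of the proof: weights and time gaps become small together and no weight is lost. A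
  chain of total weight at least \<open>r' > r\<close> with equal weights \<open>w\<close> is modified by replacing its links
  of time gap at least \<open>\<eta>\<close> by fine chains of weight \<open>0\<close>. The loss of \<open>w\<close> at such a link is at
  most \<open>w / \<eta>\<close> times its gap. Charging this amount to every link, replaced or not, avoids
  counting, because the gaps telescope to \<open>T q - T p\<close>.
\<close>

lemma admissible_refinement:
  assumes mid: "approximate_tau_midpoints chron \<tau>" and l: "admissible l" and "0 < \<eta>"
  obtains ls where "subdivides ls l"
    "\<And>k. k \<in> set ls \<Longrightarrow> admissible k \<and> wt k < \<eta> \<and> gap k < \<eta>"
proof -
  define p q r where "p = src l" and "q = tgt l" and "r = wt l"
  have r: "0 \<le> r" "ennreal r < \<tau> p q"
    using l by (auto simp: admissible_def p_def q_def r_def)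
  obtain r' where r': "r < r'" "ennreal r' < \<tau> p q"
  proof -
    obtain x where x: "ennreal r < x" "x < \<tau> p q" using dense r(2) by blast
    then obtain r' where "x = ennreal r'" by (cases x) auto
    with x r that show ?thesis by (auto simp: ennreal_less_iff)
  qed
  \<comment> \<open>The number of halvings keeps the total charge \<open>w / \<eta> * (T q - T p)\<close> below \<open>r' - r\<close>.\<close>
  have "(\<lambda>n. r' / 2 ^ n) \<longlonglongrightarrow> 0"
    using LIMSEQ_divide_realpow_zero[of 2 r'] by simp
  moreover have "0 < min \<eta> ((r' - r) * \<eta> / (T q - T p))"
    using \<open>0 < \<eta>\<close> r' admissible_chron[OF l] chron_time_less by (simp add: p_def q_def)
  ultimately have "\<forall>\<^sub>F n in sequentially. r' / 2 ^ n < min \<eta> ((r' - r) * \<eta> / (T q - T p))"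
    by (rule order_tendstoD)
  then obtain n where n: "r' / 2 ^ n < min \<eta> ((r' - r) * \<eta> / (T q - T p))"
    by (auto simp: eventually_sequentially)
  define w where "w = r' / 2 ^ n"
  have Tpq: "0 < T q - T p"
    using admissible_chron[OF l] chron_time_less by (simp add: p_def q_def)
  have w: "0 \<le> w" "w < \<eta>" "w < (r' - r) * \<eta> / (T q - T p)"
    using n r r' by (auto simp: w_def)
  then have wT: "w / \<eta> * (T q - T p) \<le> r' - r"
    using Tpq \<open>0 < \<eta>\<close> by (simp add: pos_less_divide_eq pos_divide_le_eq)
  obtain ls where ls: "ls \<noteq> []" "chain p ls q" "r' \<le> weight ls"
    "\<And>k. k \<in> set ls \<Longrightarrow> admissible k \<and> wt k = w"
    using even_chain_from_midpoints[OF mid _ r'(2), of n] r(1) r'(1) unfolding w_def by auto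
  have "\<exists>ks. ks \<noteq> [] \<and> chain (src k) ks (tgt k) \<and>
      (\<forall>j\<in>set ks. admissible j \<and> wt j < \<eta> \<and> gap j < \<eta>) \<and> w - w / \<eta> * gap k \<le> weight ks"
    if k: "k \<in> set ls" for k
  proof (cases "gap k < \<eta>")
    case True
    have "0 \<le> gap k" using ls(4)[OF k] admissible_chron chron_time_less by fastforce
    then have "0 \<le> w / \<eta> * gap k" using w \<open>0 < \<eta>\<close> by (intro mult_nonneg_nonneg) auto
    then show ?thesis
      using True ls(4)[OF k] w by (intro exI[of _ "[k]"]) auto
  next
    case False
    obtain ks where ks: "ks \<noteq> []" "chain (src k) ks (tgt k)"
      "\<And>j. j \<in> set ks \<Longrightarrow> admissible j \<and> wt j = 0 \<and> gap j < \<eta>"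
      using fine_chain_from_bisection[OF admissible_chron \<open>0 < \<eta>\<close>] ls(4)[OF k] by metis
    have "weight ks = (\<Sum>j\<leftarrow>ks. 0)"
      using ks(3) by (intro arg_cong[of _ _ sum_list] map_cong) auto
    moreover have "w \<le> w / \<eta> * gap k"
      using False w \<open>0 < \<eta>\<close> mult_left_mono[of 1 "gap k / \<eta>" w] by (simp add: field_simps)
    ultimately show ?thesis
      using ks \<open>0 < \<eta>\<close> by (intro exI[of _ ks]) auto
  qed
  then obtain f where f: "\<And>k. k \<in> set ls \<Longrightarrow> f k \<noteq> []"
    "\<And>k. k \<in> set ls \<Longrightarrow> chain (src k) (f k) (tgt k)"
    "\<And>k j. k \<in> set ls \<Longrightarrow> j \<in> set (f k) \<Longrightarrow> admissible j \<and> wt j < \<eta> \<and> gap j < \<eta>"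
    "\<And>k. k \<in> set ls \<Longrightarrow> w - w / \<eta> * gap k \<le> weight (f k)"
    by metis
  have "r \<le> weight ls - w / \<eta> * (T q - T p)"
    using ls wT by simp
  also have "\<dots> = (\<Sum>k\<leftarrow>ls. wt k - w / \<eta> * gap k)"
    unfolding chain_telescope[OF ls(2), symmetric] sum_list_const_mult[symmetric]
    by (rule sum_list_subtractf[symmetric])
  also have "\<dots> \<le> (\<Sum>k\<leftarrow>ls. weight (f k))"
    using f(4) ls(4) by (intro sum_list_mono) auto
  also have "\<dots> = weight (concat (map f ls))"
    by (induction ls) auto
  finally have "r \<le> weight (concat (map f ls))" .
  moreover have "chain p (concat (map f ls)) q"
    using ls(2) f(2) by (rule chain_concat)
  moreover have "concat (map f ls) \<noteq> []"
    using ls(1) f(1) by (cases ls) auto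
  ultimately show ?thesis
    using that[of "concat (map f ls)"] f(3) by (auto simp: subdivides_def p_def q_def r_def)
qed

end

section \<open>The curve carried by a time-dense chain\<close>

lemma locally_causally_closed_converse:
  assumes "locally_causally_closed R"
  shows "locally_causally_closed (conversep R)"
  unfolding locally_causally_closed_def
proof
  fix x
  obtain U where U: "x \<in> interior U"
    "\<And>P Q p q. P \<longlonglongrightarrow> p \<Longrightarrow> Q \<longlonglongrightarrow> q \<Longrightarrow> (\<And>n::nat. P n \<in> U \<and> Q n \<in> U) \<Longrightarrow>
      p \<in> closure U \<Longrightarrow> q \<in> closure U \<Longrightarrow> (\<And>n. R (P n) (Q n)) \<Longrightarrow> R p q"
    using assms unfolding locally_causally_closed_def by metis
  then show "\<exists>U. x \<in> interior U \<and>
      (\<forall>P Q p q. P \<longlonglongrightarrow> p \<longrightarrow> Q \<longlonglongrightarrow> q \<longrightarrow> (\<forall>n::nat. P n \<in> U \<and> Q n \<in> U) \<longrightarrow>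
        p \<in> closure U \<longrightarrow> q \<in> closure U \<longrightarrow> (\<forall>n. R\<inverse>\<inverse> (P n) (Q n)) \<longrightarrow> R\<inverse>\<inverse> p q)"
    by (intro exI[of _ U]) auto
qed

text \<open>
  Local closedness says nothing about a limit point \<open>u\<close> and a distant \<open>z\<close>. Density of the times
  supplies a chain point \<open>z'\<close> between them that is close to \<open>u\<close>: closedness near \<open>u\<close> gives
  \<open>R u z'\<close>, and \<open>R z' z\<close> holds in the chain. A chain with a time gap just after \<open>u\<close> would admit no
  such \<open>z'\<close>, which is why the time gaps have to be controlled. The relation \<open>R\<close> and the function
  \<open>T\<close> are arbitrary so that the statement for limit points from the other side is the instance
  \<open>causal\<inverse>\<inverse>\<close>, \<open>- T\<close>.
\<close>

lemma dense_chain_limit_related: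
  fixes T :: "'a::metric_space \<Rightarrow> real"
  assumes closed: "locally_causally_closed R" and trans: "transp R"
    and cont: "continuous_on UNIV T"
    and chain: "\<And>u v. u \<in> C \<Longrightarrow> v \<in> C \<Longrightarrow> T u < T v \<Longrightarrow> R u v"
    and dist: "\<And>u v. u \<in> closure C \<Longrightarrow> v \<in> closure C \<Longrightarrow> dist u v = \<bar>T u - T v\<bar>"
    and dense: "\<And>s t. \<alpha> \<le> s \<Longrightarrow> s < t \<Longrightarrow> t \<le> \<beta> \<Longrightarrow> \<exists>z\<in>C. s < T z \<and> T z < t"
    and u: "u \<in> closure C" "\<alpha> \<le> T u" and z: "z \<in> C" "T z \<le> \<beta>" and less: "T u < T z"
  shows "R u z"
proof -
  obtain U where U: "u \<in> interior U"
    "\<And>P Q p q. P \<longlonglongrightarrow> p \<Longrightarrow> Q \<longlonglongrightarrow> q \<Longrightarrow> (\<And>n::nat. P n \<in> U \<and> Q n \<in> U) \<Longrightarrow>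
      p \<in> closure U \<Longrightarrow> q \<in> closure U \<Longrightarrow> (\<And>n. R (P n) (Q n)) \<Longrightarrow> R p q"
    using closed unfolding locally_causally_closed_def by metis
  obtain e where e: "0 < e" "ball u e \<subseteq> U"
    using U(1) mem_interior by blast
  obtain z' where z': "z' \<in> C" "T u < T z'" "T z' < min (T u + e) (T z)"
    using dense[of "T u" "min (T u + e) (T z)"] u z less e by (auto simp: min_le_iff_disj)
  have "z' \<in> closure C" using z'(1) closure_subset by blast
  then have "z' \<in> U"
    using dist[OF u(1)] z' e by auto
  obtain f where f: "\<And>n. f n \<in> C" "f \<longlonglongrightarrow> u"
    using u(1) by (auto simp: closure_sequential)
  have "(\<lambda>n. T (f n)) \<longlonglongrightarrow> T u"
    using cont f(2) by (rule continuous_on_tendsto_compose) auto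
  then have "\<forall>\<^sub>F n in sequentially. T (f n) < T z'"
    using z'(2) by (rule order_tendstoD)
  moreover have "\<forall>\<^sub>F n in sequentially. f n \<in> ball u e"
    using f(2) e(1) by (auto simp: tendsto_iff dist_commute)
  ultimately have "\<forall>\<^sub>F n in sequentially. T (f n) < T z' \<and> f n \<in> U"
    by eventually_elim (use e in auto)
  then obtain N where N: "\<And>n. N \<le> n \<Longrightarrow> T (f n) < T z' \<and> f n \<in> U"
    by (auto simp: eventually_sequentially)
  have "R u z'"
  proof (rule U(2))
    show "(\<lambda>n. f (n + N)) \<longlonglongrightarrow> u" using f(2) by (rule LIMSEQ_ignore_initial_segment)
    show "u \<in> closure U" using U(1) interior_subset closure_subset by blast
    show "z' \<in> closure U" using \<open>z' \<in> U\<close> closure_subset by blast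
    show "R (f (n + N)) z'" for n using N[of "n + N"] f(1) z'(1) chain by simp
  qed (use N \<open>z' \<in> U\<close> in auto)
  moreover have "R z' z" using chain z' z by simp
  ultimately show ?thesis using trans by (meson transpD)
qed

context null_distance_space
begin

text \<open>
  The curve is parametrised by time: \<open>T\<close> restricted to \<open>closure C\<close> is an isometry onto
  \<open>[T x, T y]\<close>, and the curve is its inverse, hence Lipschitz with constant \<open>1\<close>.
\<close>

lemma curve_through_dense_chain:
  assumes closed: "locally_causally_closed causal" and complete: "complete (UNIV :: 'a set)"
    and C: "\<And>u v. u \<in> C \<Longrightarrow> v \<in> C \<Longrightarrow> causal u v \<or> causal v u"
    and ends: "x \<in> C" "y \<in> C" "T x < T y"
    and range: "\<And>z. z \<in> C \<Longrightarrow> T x \<le> T z \<and> T z \<le> T y"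
    and dense: "\<And>s t. T x \<le> s \<Longrightarrow> s < t \<Longrightarrow> t \<le> T y \<Longrightarrow> \<exists>z\<in>C. s < T z \<and> T z < t"
  obtains \<gamma> where "directed_curve_from_to causal x y (T x) (T y) \<gamma>"
    and "\<And>z. z \<in> C \<Longrightarrow> \<gamma> (T z) = z"
proof -
  have tendsto_T: "(\<lambda>n. T (f n)) \<longlonglongrightarrow> T u" if "f \<longlonglongrightarrow> u" for f u
    using continuous_time that by (rule continuous_on_tendsto_compose) auto
  have CD: "C \<subseteq> closure C" by (rule closure_subset)
  have dist_C: "dist u v = \<bar>T u - T v\<bar>" if uv: "u \<in> C" "v \<in> C" for u v
  proof -
    consider "causal u v" | "causal v u" using C[OF uv] by blast
    then show ?thesis
      by cases (use dist_causal[of u v] dist_causal[of v u] zero_le_dist[of u v] in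
        \<open>auto simp: dist_commute\<close>)
  qed
  have dist_D: "dist u v = \<bar>T u - T v\<bar>" if uv: "u \<in> closure C" "v \<in> closure C" for u v
  proof -
    obtain f g where f: "\<And>n. f n \<in> C" "f \<longlonglongrightarrow> u" and g: "\<And>n. g n \<in> C" "g \<longlonglongrightarrow> v"
      using uv by (auto simp: closure_sequential)
    have "(\<lambda>n. dist (f n) (g n)) \<longlonglongrightarrow> \<bar>T u - T v\<bar>"
      unfolding dist_C[OF f(1) g(1)] by (intro tendsto_intros tendsto_T f g)
    moreover have "(\<lambda>n. dist (f n) (g n)) \<longlonglongrightarrow> dist u v"
      by (intro tendsto_intros f g)
    ultimately show ?thesis using LIMSEQ_unique by blast
  qed
  have "closure C \<subseteq> T -` {T x..T y}"
    using range by (intro closure_minimal closed_vimage continuous_time) auto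
  then have range_D: "T x \<le> T u \<and> T u \<le> T y" if "u \<in> closure C" for u
    using that by auto
  have causal_D: "causal u v" if uv: "u \<in> closure C" "v \<in> closure C" "T u < T v" for u v
  proof -
    have causal_C: "causal w z" if "w \<in> C" "z \<in> C" "T w < T z" for w z
      using C[OF that(1,2)] time_less[of z w] that(3) by fastforce
    obtain z where z: "z \<in> C" "T u < T z" "T z < T v"
      using dense[of "T u" "T v"] range_D[OF uv(1)] range_D[OF uv(2)] uv(3) by blast
    have "causal u z"
      by (rule dense_chain_limit_related[OF closed causal_trans continuous_time causal_C dist_D dense])
        (use that z range_D range in auto)
    moreover have "causal\<inverse>\<inverse> v z"
    proof (rule dense_chain_limit_related[of _ "\<lambda>w. - T w" C "- T y" "- T x"])
      show "locally_causally_closed causal\<inverse>\<inverse>"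
        by (rule locally_causally_closed_converse[OF closed])
      show "transp causal\<inverse>\<inverse>"
        using causal_trans by simp
      show "continuous_on UNIV (\<lambda>w. - T w)"
        by (intro continuous_intros continuous_time)
      show "\<exists>w\<in>C. s < - T w \<and> - T w < t" if "- T y \<le> s" "s < t" "t \<le> - T x" for s t
        using dense[of "-t" "-s"] that by force
    qed (use that z range_D range dist_D causal_C in auto)
    ultimately show ?thesis using causal_transD by blast
  qed
  have surj: "\<exists>u\<in>closure C. T u = s" if s: "T x \<le> s" "s \<le> T y" for s
  proof -
    have "\<exists>z\<in>C. \<bar>T z - s\<bar> < 1 / real (Suc n)" for n
    proof (cases "s = T y")
      case True
      then show ?thesis using ends by (intro bexI[of _ y]) auto
    next
      case False
      then obtain z where "z \<in> C" "s < T z" "T z < min (s + 1 / real (Suc n)) (T y)"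
        using dense[of s "min (s + 1 / real (Suc n)) (T y)"] s by auto
      then show ?thesis by (intro bexI[of _ z]) auto
    qed
    then obtain f where f: "\<And>n. f n \<in> C" "\<And>n. \<bar>T (f n) - s\<bar> < 1 / real (Suc n)"
      by metis
    have "(\<lambda>n. T (f n) - s) \<longlonglongrightarrow> 0"
    proof (rule Lim_null_comparison)
      show "\<forall>\<^sub>F n in sequentially. norm (T (f n) - s) \<le> 1 / real (Suc n)"
        using f(2) by (intro always_eventually) (auto intro: less_imp_le)
      show "(\<lambda>n. 1 / real (Suc n)) \<longlonglongrightarrow> 0"
        using LIMSEQ_inverse_real_of_nat by (simp add: inverse_eq_divide)
    qed
    then have Tf: "(\<lambda>n. T (f n)) \<longlonglongrightarrow> s"
      by (simp add: LIM_zero_iff)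
    then have "Cauchy (\<lambda>n. T (f n))"
      by (rule LIMSEQ_imp_Cauchy)
    then have "Cauchy f"
      by (simp add: Cauchy_def dist_C[OF f(1) f(1)] dist_real_def)
    then obtain u where u: "f \<longlonglongrightarrow> u"
      using complete by (auto simp: complete_def)
    have "T u = s"
      using LIMSEQ_unique[OF tendsto_T[OF u] Tf] .
    moreover have "u \<in> closure C"
      using f(1) u by (auto simp: closure_sequential)
    ultimately show ?thesis by blast
  qed
  define \<gamma> where "\<gamma> s = (SOME u. u \<in> closure C \<and> T u = s)" for s
  have \<gamma>: "\<gamma> s \<in> closure C" "T (\<gamma> s) = s" if "T x \<le> s" "s \<le> T y" for s
    unfolding \<gamma>_def using someI_ex[of "\<lambda>u. u \<in> closure C \<and> T u = s"] surj[OF that] by auto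
  have \<gamma>_T: "\<gamma> (T z) = z" if "z \<in> C" for z
  proof -
    have "dist (\<gamma> (T z)) z = 0"
      using \<gamma>[of "T z"] dist_D[of "\<gamma> (T z)" z] range[OF that] that CD by auto
    then show ?thesis by simp
  qed
  have lip: "1-lipschitz_on {T x..T y} \<gamma>"
    using \<gamma> by (intro lipschitz_onI) (auto simp: dist_D dist_real_def)
  have "directed_curve causal {T x..T y} \<gamma>"
    unfolding directed_curve_def
  proof (intro conjI)
    show "is_interval {T x..T y}" by (rule is_interval_cc)
    show "\<not> \<gamma> constant_on {T x..T y}"
    proof
      assume "\<gamma> constant_on {T x..T y}"
      then have "\<gamma> (T x) = \<gamma> (T y)" using ends(3) by (auto simp: constant_on_def)
      then show False using \<gamma>_T ends by auto
    qed
    show "locally_lipschitz_on {T x..T y} \<gamma>"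
      unfolding locally_lipschitz_on_def
      using lipschitz_on_subset[OF lip] by (meson inf_le2 zero_less_one)
    show "\<forall>s\<in>{T x..T y}. \<forall>t\<in>{T x..T y}. s < t \<longrightarrow> causal (\<gamma> s) (\<gamma> t)"
      using \<gamma> causal_D by auto
  qed
  then have "directed_curve_from_to causal x y (T x) (T y) \<gamma>"
    using ends \<gamma>_T by (simp add: directed_curve_from_to_def)
  then show ?thesis using \<gamma>_T by (rule that)
qed

section \<open>Almost maximal curves\<close>

lemma partition_bounds:
  assumes "is_partition a b n t" "i \<le> n"
  shows "a \<le> t i" "t i \<le> b"
proof -
  have step: "t j \<le> t (Suc j)" if "j < n" for j
    using assms(1) that by (auto simp: is_partition_def less_imp_le)
  have "t 0 \<le> t i"
    using assms(2) by (induction i) (use step in \<open>auto intro: order_trans\<close>)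
  moreover have "t i \<le> t n"
    using assms(2) by (induction rule: inc_induct) (use step in \<open>auto intro: order_trans\<close>)
  ultimately show "a \<le> t i" "t i \<le> b"
    using assms(1) by (auto simp: is_partition_def)
qed

text \<open>
  The curve runs through the points of all finite chains, so every partition of it can be compared
  with every one of them.
\<close>

lemma almost_maximal_curve:
  assumes closed: "locally_causally_closed causal" and complete: "complete (UNIV :: 'a set)"
    and mid: "approximate_tau_midpoints chron \<tau>"
    and r: "0 \<le> r" "ennreal r < \<tau> x y"
  obtains \<gamma> where "directed_curve_from_to causal x y (T x) (T y) \<gamma>"
    and "ennreal r \<le> tau_length \<tau> (T x) (T y) \<gamma>"
proof -
  define P where "P = (\<lambda>n l. admissible l \<and> (0 < n \<longrightarrow> wt l < 1 / real n \<and> gap l < 1 / real n))"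
  have base: "P 0 (Link x y r)"
    using r by (simp add: P_def admissible_def)
  have step: "\<exists>ls. subdivides ls k \<and> (\<forall>k'\<in>set ls. P (Suc n) k')" if "P n k" for n k
    using admissible_refinement[OF mid, of k "1 / real (Suc n)"] that unfolding P_def
    by (metis of_nat_0_less_iff zero_less_Suc zero_less_divide_1_iff)
  obtain G where G0: "G 0 = [Link x y r]"
    and sub: "\<And>n. subdivides (G n) (Link x y r)" and P: "\<And>n k. k \<in> set (G n) \<Longrightarrow> P n k"
    and pts: "\<And>n. points (G n) \<subseteq> points (G (Suc n))"
    by (rule iterated_subdivision[of P, OF base step], assumption) (rule that)
  have chain: "chain x (G n) y" and weight: "r \<le> weight (G n)" for n
    using sub[of n] by (simp_all add: subdivides_def)
  have adm: "\<forall>l\<in>set (G n). admissible l" for n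
    using P by (auto simp: P_def)
  define C where "C = (\<Union>n. points (G n))"
  have xy: "chron x y" "T x < T y"
    using admissible_chron[of "Link x y r"] chron_time_less base by (auto simp: P_def)
  have "points (G 0) = {x, y}"
    by (simp add: G0 points_def insert_commute)
  then have ends: "x \<in> C" "y \<in> C"
    unfolding C_def by blast+
  have between: "causal x u" "causal u y" if "u \<in> C" for u
    using that chain_points_between[OF chain adm] by (auto simp: C_def)
  have range: "T x \<le> T u \<and> T u \<le> T y" if "u \<in> C" for u
    using between[OF that] dist_causal[of x u] dist_causal[of u y]
      zero_le_dist[of x u] zero_le_dist[of u y] by linarith
  have total: "causal u v \<or> causal v u" if uv: "u \<in> C" "v \<in> C" for u v
  proof -
    obtain m n where "u \<in> points (G m)" "v \<in> points (G n)"
      using uv by (auto simp: C_def)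
    then have "u \<in> points (G (max m n))" "v \<in> points (G (max m n))"
      using lift_Suc_mono_le[of "\<lambda>n. points (G n)", OF pts]
      by (meson max.cobounded1 max.cobounded2 subsetD)+
    then show ?thesis
      using chain_points_total[OF chain adm] by blast
  qed
  \<comment> \<open>The time gap of the link crossing \<open>(s + t) / 2\<close> is below \<open>(t - s) / 2\<close>, so it starts after \<open>s\<close>.\<close>
  have dense: "\<exists>z\<in>C. s < T z \<and> T z < t" if st: "T x \<le> s" "s < t" "t \<le> T y" for s t
  proof -
    obtain n where n: "inverse (real (Suc n)) < (t - s) / 2"
      using reals_Archimedean[of "(t - s) / 2"] st by auto
    have "T x \<le> (s + t) / 2" "\<not> T y \<le> (s + t) / 2"
      using st by auto
    then obtain ls1 l ls2 where l: "G (Suc n) = ls1 @ l # ls2"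
      "T (src l) \<le> (s + t) / 2" "\<not> T (tgt l) \<le> (s + t) / 2"
      by (rule chain_crossing[OF chain[of "Suc n"], where A = "\<lambda>u. T u \<le> (s + t) / 2"])
    have "gap l < 1 / real (Suc n)"
      using P[of l "Suc n"] l(1) by (simp add: P_def)
    then have "gap l < (t - s) / 2"
      using n unfolding inverse_eq_divide by (rule less_trans)
    then have "s < T (src l)" "T (src l) < t"
      using l(2,3) st by (auto simp: field_simps)
    moreover have "src l \<in> C"
      using l(1) by (auto simp: C_def points_def intro!: exI[of _ "Suc n"])
    ultimately show ?thesis by blast
  qed
  obtain \<gamma> where \<gamma>: "directed_curve_from_to causal x y (T x) (T y) \<gamma>"
    and \<gamma>_T: "\<And>z. z \<in> C \<Longrightarrow> \<gamma> (T z) = z"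
    using curve_through_dense_chain[OF closed complete total ends xy(2) range dense] by blast
  have mono: "causal (\<gamma> s) (\<gamma> t)" if "T x \<le> s" "s \<le> t" "t \<le> T y" for s t
    using \<gamma> that causal_reflD
    by (cases "s = t") (auto simp: directed_curve_from_to_def directed_curve_def)
  have "ennreal r \<le> (\<Sum>i<N. \<tau> (\<gamma> (t i)) (\<gamma> (t (Suc i))))"
    if part: "is_partition (T x) (T y) N t" for N t
  proof (rule ennreal_le_epsilon)
    fix e :: real assume "0 < e"
    obtain n where n: "real N / e < real n" "0 < n"
      using reals_Archimedean2[of "max (real N / e) 0"] by auto
    then have Ne: "real N * (1 / real n) \<le> e"
      using \<open>0 < e\<close> by (simp add: field_simps)
    note t = partition_bounds[OF part]
    have "ennreal r \<le> ennreal (weight (G n))"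
      using weight by (rule ennreal_leI)
    also have "\<dots> \<le> (\<Sum>i<N. \<tau> (\<gamma> (t i)) (\<gamma> (t (Suc i)))) + of_nat N * ennreal (1 / real n)"
    proof (rule chain_weight_le_partition_sum[OF tau_refl _ chain, of _ _ "\<lambda>i. \<gamma> (t i)"])
      show "\<forall>l\<in>set (G n). admissible l \<and> wt l \<le> 1 / real n"
        using P[of _ n] n(2) by (auto simp: P_def less_imp_le)
      show "causal (\<gamma> (t 0)) x" "causal y (\<gamma> (t N))"
        using part \<gamma> causal_reflD by (auto simp: is_partition_def directed_curve_from_to_def)
      show "causal (\<gamma> (t i)) (\<gamma> (t (Suc i)))" if "i < N" for i
        using that part t[of i] t[of "Suc i"] by (intro mono) (auto simp: is_partition_def less_imp_le)
      show "causal u (\<gamma> (t i)) \<or> causal (\<gamma> (t i)) u"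
        if "i \<le> N" "u \<in> insert y (points (G n))" for i u
      proof -
        have u: "u \<in> C" using that ends by (auto simp: C_def)
        then show ?thesis
          using mono[of "T u" "t i"] mono[of "t i" "T u"] \<gamma>_T[OF u] range[OF u] t[OF that(1)]
          by (cases "T u \<le> t i") auto
      qed
    qed auto
    also have "of_nat N * ennreal (1 / real n) = ennreal (real N * (1 / real n))"
      by (simp add: ennreal_mult ennreal_of_nat_eq_real_of_nat del: times_divide_eq_right)
    also have "\<dots> \<le> ennreal e"
      using Ne by (rule ennreal_leI)
    finally show "ennreal r \<le> (\<Sum>i<N. \<tau> (\<gamma> (t i)) (\<gamma> (t (Suc i)))) + ennreal e"
      by (simp add: add_left_mono)
  qed
  then have "ennreal r \<le> tau_length \<tau> (T x) (T y) \<gamma>"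
    unfolding tau_length_def by (intro Inf_greatest) auto
  with \<gamma> show ?thesis by (rule that)
qed

lemma tau_length_le_tau:
  assumes "directed_curve_from_to causal x y a b \<gamma>"
  shows "tau_length \<tau> a b \<gamma> \<le> \<tau> x y"
proof -
  define t where "t i = (if i = 0 then a else b)" for i :: nat
  have "is_partition a b 1 t"
    using directed_curve_less[OF assms] by (simp add: is_partition_def t_def)
  then have "tau_length \<tau> a b \<gamma> \<le> (\<Sum>i<1. \<tau> (\<gamma> (t i)) (\<gamma> (t (Suc i))))"
    unfolding tau_length_def by (intro Inf_lower) blast
  then show ?thesis
    using assms by (simp add: directed_curve_from_to_def t_def)
qed

end

theorem theorem3p3:
  fixes chron causal :: "'a::metric_space \<Rightarrow> 'a \<Rightarrow> bool"
    and \<tau> :: "'a \<Rightarrow> 'a \<Rightarrow> ennreal"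
    and T :: "'a \<Rightarrow> real"
  assumes "lorentzian_pre_length_space chron causal \<tau>"
    and "locally_causally_closed causal"
    and "sufficiently_causally_connected chron causal"
    and "is_time_function causal T"
    and "\<forall>p q. null_distance causal T p q = ennreal (dist p q)"
    and "complete (UNIV :: 'a set)"
    and "approximate_tau_midpoints chron \<tau>"
    and "\<exists>c \<epsilon>::real. 0 < c \<and> c \<le> 1/2 \<and> 0 < \<epsilon> \<and>
           (\<forall>p q. chron p q \<longrightarrow>
              (\<exists>m. tau_midpoint \<tau> (\<tau> p q * ennreal \<epsilon>) p q m \<and>
                   (1 - c) * T p + c * T q \<le> T m \<and> T m \<le> c * T p + (1 - c) * T q))"
  shows "intrinsic causal \<tau>"
proof -
  interpret lorentzian_pre_length_space chron causal \<tau>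
    by (rule assms(1))
  interpret null_distance_space chron causal \<tau> T
    using assms(3-5) by unfold_locales (auto simp: sufficiently_causally_connected_def)
  show ?thesis
    unfolding intrinsic_def
  proof (intro allI antisym)
    fix x y
    let ?L = "{tau_length \<tau> a b \<gamma> | a b \<gamma>. directed_curve_from_to causal x y a b \<gamma>}"
    show "Sup ?L \<le> \<tau> x y"
      using tau_length_le_tau by (intro Sup_least) auto
    show "\<tau> x y \<le> Sup ?L"
    proof (rule dense_le)
      fix s assume "s < \<tau> x y"
      then obtain r where r: "0 \<le> r" "s = ennreal r"
        by (cases s) auto
      then obtain \<gamma> where "directed_curve_from_to causal x y (T x) (T y) \<gamma>"
        "s \<le> tau_length \<tau> (T x) (T y) \<gamma>"
        using almost_maximal_curve[OF assms(2,6,7)] \<open>s < \<tau> x y\<close> by metis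
      then show "s \<le> Sup ?L"
        by (intro Sup_upper2[of "tau_length \<tau> (T x) (T y) \<gamma>"]) auto
    qed
  qed
qed

end
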